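(* Let $\lambda_1,\lambda_2\in[0,1]$. If $G_1$ is an $(N_1,D_1,\lambda_1)$-graph on $[N_1]$ and $G_2$ is a $(D_1,D_2,\lambda_2)$-graph on $[D_1]$, then their zig-zag product is an $(N_1\cdot D_1,\,D_2^2,\,f(\lambda_1,\lambda_2))$-graph, where $$f(\lambda_1,\lambda_2)=\frac12(1-\lambda_2^2)\lambda_1+\frac12\sqrt{(1-\lambda_2^2)^2\lambda_1^2+4\lambda_2^2}.$$
   Context: For a positive integer $n$, $[n]=\{1,\dots,n\}$. Graphs are finite, undirected and regular, and may have self-loops and parallel edges. A $D$-regular graph $G$ on $[N]$ is specified by its rotation map $\mathrm{Rot}_G:[N]\times[D]\to[N]\times[D]$: $\mathrm{Rot}_G(v,i)=(w,j)$ means that the $i$-th edge incident to $v$ leads to $w$ and that this edge is the $j$-th edge incident to $w$. Thus $\mathrm{Rot}_G$ is a permutation with $\mathrm{Rot}_G\circ\mathrm{Rot}_G=\mathrm{id}$ (and any such involution specifies a $D$-regular graph). Vertex sets and sets of edge labels may be any finite sets of the right cardinality. The normalized adjacency matrix of $G$ is the symmetric $N\times N$ matrix with $M_{u,v}=\frac1D|\{(i,j)\in[D]^2:\mathrm{Rot}_G(u,i)=(v,j)\}|$. The second largest eigenvalue in absolute value is $\lambda(G)=\max_{\alpha\perp 1_N,\,\alpha\ne0}\|M\alpha\|/\|\alpha\|$, where $1_N$ is the all-ones vector and the norm is Euclidean (with $\lambda(G)=0$ if $N=1$). An $(N,D,\lambda)$-graph is a $D$-regular graph on $N$ vertices with $\lambda(G)\le\lambda$.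 Zig-zag product: for a $D_1$-regular graph $G_1$ on $[N_1]$ and a $D_2$-regular graph $G_2$ on $[D_1]$, it is the $D_2^2$-regular graph on $[N_1]\times[D_1]$, with edge labels in $[D_2]\times[D_2]$, whose rotation map sends $((v,k),(i,j))$ to $((w,\ell),(j',i'))$, where $(k',i')=\mathrm{Rot}_{G_2}(k,i)$, then $(w,\ell')=\mathrm{Rot}_{G_1}(v,k')$, then $(\ell,j')=\mathrm{Rot}_{G_2}(\ell',j)$. *)

theory Defs
  imports "HOL-Analysis.Analysis"
begin

text \<open>
  A regular graph with vertex set \<open>'v\<close> and edge labels \<open>'l\<close> (finite, nonempty types) is given by
  its rotation map; \<open>G (v, i) = (w, j)\<close> means that the \<open>i\<close>-th edge at \<open>v\<close> leads to \<open>w\<close>, where it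
  is the \<open>j\<close>-th edge.  The number of vertices is \<open>CARD('v)\<close>, the degree is \<open>CARD('l)\<close>.
\<close>

type_synonym ('v, 'l) rot = "'v \<times> 'l \<Rightarrow> 'v \<times> 'l"

definition rotation_map :: "('v, 'l) rot \<Rightarrow> bool" where
  "rotation_map G \<longleftrightarrow> G \<circ> G = id"

lemma rotation_map_bij: "rotation_map G \<Longrightarrow> bij G"
  unfolding rotation_map_def by (rule o_bij)

definition adj_matrix :: "('v::finite, 'l::finite) rot \<Rightarrow> real ^ 'v ^ 'v" where
  "adj_matrix G = (\<chi> u v. real (card {(i, j). G (u, i) = (v, j)}) / real CARD('l))"

definition eigen_ratios :: "('v::finite, 'l::finite) rot \<Rightarrow> real set" where
  "eigen_ratios G =
     {norm (adj_matrix G *v \<alpha>) / norm \<alpha> | \<alpha>. \<alpha> \<bullet> (\<chi> v. 1) = 0 \<and> \<alpha> \<noteq> 0}"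

text \<open>
  The set of ratios is empty for a single vertex, hence the case distinction.  Otherwise its
  supremum is a maximum, see \<open>second_eigenvalue_max\<close> below.
\<close>

definition second_eigenvalue :: "('v::finite, 'l::finite) rot \<Rightarrow> real" where
  "second_eigenvalue G = (if CARD('v) = 1 then 0 else Sup (eigen_ratios G))"

lemma eigen_ratios_nonempty:
  fixes G :: "('v::finite, 'l::finite) rot"
  assumes "CARD('v) \<noteq> 1"
  shows "eigen_ratios G \<noteq> {}"
proof -
  obtain a b :: 'v where ab: "a \<noteq> b"
    using assms by (metis (full_types) UNIV_eq_I card_1_singleton_iff insertCI One_nat_def)
  define x :: "real ^ 'v" where "x = axis a 1 - axis b 1"
  have "x \<bullet> (\<chi> v. 1) = 0"
    by (simp add: x_def inner_diff_left inner_axis_axis inner_axis')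
  moreover have "x $ a = 1"
    using ab by (simp add: x_def axis_def)
  hence "x \<noteq> 0" by auto
  ultimately show ?thesis
    unfolding eigen_ratios_def by blast
qed

lemma second_eigenvalue_max:
  fixes G :: "('v::finite, 'l::finite) rot"
  assumes "CARD('v) \<noteq> 1"
  shows "second_eigenvalue G \<in> eigen_ratios G"
    and "x \<in> eigen_ratios G \<Longrightarrow> x \<le> second_eigenvalue G"
proof -
  define S :: "(real ^ 'v) set" where "S = sphere 0 1 \<inter> {\<alpha>. (\<chi> v. 1) \<bullet> \<alpha> = 0}"
  have "eigen_ratios G = (\<lambda>\<alpha>. norm (adj_matrix G *v \<alpha>)) ` S"
  proof (intro equalityI subsetI)
    fix r assume "r \<in> eigen_ratios G"
    then obtain \<alpha> :: "real ^ 'v" where \<alpha>: "\<alpha> \<bullet> (\<chi> v. 1) = 0" "\<alpha> \<noteq> 0"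
      and r: "r = norm (adj_matrix G *v \<alpha>) / norm \<alpha>"
      unfolding eigen_ratios_def by blast
    have "(1 / norm \<alpha>) *\<^sub>R \<alpha> \<in> S"
      using \<alpha> by (simp add: S_def inner_commute)
    moreover have "r = norm (adj_matrix G *v ((1 / norm \<alpha>) *\<^sub>R \<alpha>))"
      by (simp add: r matrix_vector_mult_scaleR)
    ultimately show "r \<in> (\<lambda>\<alpha>. norm (adj_matrix G *v \<alpha>)) ` S"
      by blast
  next
    fix r assume "r \<in> (\<lambda>\<alpha>. norm (adj_matrix G *v \<alpha>)) ` S"
    then obtain \<alpha> where \<alpha>: "\<alpha> \<in> S" "r = norm (adj_matrix G *v \<alpha>)"
      by blast
    hence "\<alpha> \<bullet> (\<chi> v. 1) = 0" "norm \<alpha> = 1"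
      by (auto simp: S_def inner_commute)
    moreover from this have "\<alpha> \<noteq> 0" by auto
    ultimately show "r \<in> eigen_ratios G"
      unfolding eigen_ratios_def using \<alpha>(2) by (auto intro!: exI[of _ \<alpha>])
  qed
  moreover have "compact S"
    unfolding S_def by (intro compact_Int_closed compact_sphere closed_hyperplane)
  moreover have "continuous_on S (\<lambda>\<alpha>. norm (adj_matrix G *v \<alpha>))"
    by (intro continuous_intros linear_continuous_on matrix_vector_mul_bounded_linear)
  ultimately have c: "compact (eigen_ratios G)"
    by (simp add: compact_continuous_image)
  show "second_eigenvalue G \<in> eigen_ratios G"
    using closed_contains_Sup[OF eigen_ratios_nonempty[OF assms]
        bounded_imp_bdd_above[OF compact_imp_bounded[OF c]] compact_imp_closed[OF c]] assms
    by (simp add: second_eigenvalue_def)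
  show "x \<in> eigen_ratios G \<Longrightarrow> x \<le> second_eigenvalue G"
    using assms c
    by (simp add: second_eigenvalue_def cSup_upper compact_imp_bounded bounded_imp_bdd_above)
qed

definition expander_graph ::
    "nat \<Rightarrow> nat \<Rightarrow> real \<Rightarrow> ('v::finite, 'l::finite) rot \<Rightarrow> bool" where
  "expander_graph N D l G \<longleftrightarrow>
     CARD('v) = N \<and> CARD('l) = D \<and> rotation_map G \<and> second_eigenvalue G \<le> l"

definition zig_zag :: "('v, 'd) rot \<Rightarrow> ('d, 'e) rot \<Rightarrow> ('v \<times> 'd, 'e \<times> 'e) rot" where
  "zig_zag G1 G2 = (\<lambda>((v, k), (i, j)).
     let (k', i') = G2 (k, i);
         (w, l') = G1 (v, k');
         (l, j') = G2 (l', j)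
     in ((w, l), (j', i')))"

definition zz_bound :: "real \<Rightarrow> real \<Rightarrow> real" where
  "zz_bound a b =
     1 / 2 * (1 - b\<^sup>2) * a + 1 / 2 * sqrt ((1 - b\<^sup>2)\<^sup>2 * a\<^sup>2 + 4 * b\<^sup>2)"

end

theory Submission imports Defs begin

text \<open>
  Write the normalized adjacency matrix of the zig-zag product as \<open>M = B A B\<close>, where \<open>B\<close> applies the
  matrix of \<open>G2\<close> inside every cloud \<open>{v} \<times> UNIV\<close> and \<open>A\<close> is the permutation matrix of the
  involution \<open>G1\<close>.  As \<open>M\<close> is symmetric, it suffices to bound \<open>\<bar>M \<alpha> \<bullet> \<alpha>\<bar> = \<bar>A x \<bullet> x\<bar>\<close> for
  \<open>x = B \<alpha>\<close>.  Split \<open>\<alpha>\<close> into its cloud averages \<open>\<alpha>\<^sub>0\<close> and the rest \<open>\<alpha>\<^sub>1\<close>; then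
  \<open>x = \<alpha>\<^sub>0 + B \<alpha>\<^sub>1\<close> is an orthogonal decomposition with \<open>norm (B \<alpha>\<^sub>1) \<le> \<lambda>\<^sub>2 norm \<alpha>\<^sub>1\<close>, and
  \<open>\<bar>A \<alpha>\<^sub>0 \<bullet> \<alpha>\<^sub>0\<bar> \<le> \<lambda>\<^sub>1 (norm \<alpha>\<^sub>0)\<^sup>2\<close> is the expansion of \<open>G1\<close>.  The bound \<open>f\<close> is the
  larger root of \<open>f\<^sup>2 = (1 - \<lambda>\<^sub>2\<^sup>2) \<lambda>\<^sub>1 f + \<lambda>\<^sub>2\<^sup>2\<close>.  If \<open>\<lambda>\<^sub>2 > 0\<close>, put \<open>g = f / \<lambda>\<^sub>2\<^sup>2 \<ge> 1\<close>; the operator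
  \<open>g - A\<close> is positive semidefinite with \<open>(g - A) (g + A) = g\<^sup>2 - 1\<close>, and evaluating its
  quadratic form at \<open>x - s (g + A) \<alpha>\<^sub>0\<close> with \<open>s = 1 / (g + \<lambda>\<^sub>1)\<close> gives the
  estimate.  If \<open>\<lambda>\<^sub>2 = 0\<close>, then \<open>x = \<alpha>\<^sub>0\<close> and \<open>f = \<lambda>\<^sub>1\<close>.
\<close>

section \<open>Quadratic forms\<close>

text \<open>Polarization at \<open>x\<close> and the multiple \<open>y\<close> of \<open>M x\<close>
  with the norm of \<open>x\<close>, followed by the parallelogram law, turns the bound on the form
  into one on the operator.\<close>

lemma symmetric_norm_le_quadratic_form:
  fixes M :: "'a::real_inner \<Rightarrow> 'a"
  assumes "linear M" and "subspace S" and inv: "\<And>x. x \<in> S \<Longrightarrow> M x \<in> S"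
    and sym: "\<And>x y. M x \<bullet> y = x \<bullet> M y"
    and quad: "\<And>x. x \<in> S \<Longrightarrow> \<bar>M x \<bullet> x\<bar> \<le> c * (x \<bullet> x)"
    and "0 \<le> c" and "x \<in> S"
  shows "norm (M x) \<le> c * norm x"
proof (cases "M x = 0 \<or> x = 0")
  case True
  then show ?thesis using \<open>0 \<le> c\<close> linear_0[OF \<open>linear M\<close>] by auto
next
  case False
  define r where "r = norm x / norm (M x)"
  define y where "y = r *\<^sub>R M x"
  have y: "y \<in> S"
    unfolding y_def using assms by (simp add: subspace_scale)
  have norm_y: "y \<bullet> y = x \<bullet> x"
    using False by (simp add: y_def r_def dot_square_norm power2_eq_square)
  have "M x \<bullet> y = norm (M x) * norm x"
    using False by (simp add: y_def r_def dot_square_norm power2_eq_square)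
  moreover have "4 * (M x \<bullet> y) = M (x + y) \<bullet> (x + y) - M (x - y) \<bullet> (x - y)"
    using sym[of y x]
    by (simp add: linear_add[OF \<open>linear M\<close>] linear_diff[OF \<open>linear M\<close>]
        inner_add_left inner_add_right inner_diff_left inner_diff_right inner_commute)
  moreover have "M (x + y) \<bullet> (x + y) \<le> c * ((x + y) \<bullet> (x + y))"
    using quad[OF subspace_add[OF \<open>subspace S\<close> \<open>x \<in> S\<close> y]] by linarith
  moreover have "- (M (x - y) \<bullet> (x - y)) \<le> c * ((x - y) \<bullet> (x - y))"
    using quad[OF subspace_diff[OF \<open>subspace S\<close> \<open>x \<in> S\<close> y]] by linarith
  moreover have "c * ((x + y) \<bullet> (x + y)) + c * ((x - y) \<bullet> (x - y)) = 4 * (c * (x \<bullet> x))"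
    using norm_y
    by (simp add: inner_add_left inner_add_right inner_diff_left inner_diff_right
        inner_commute algebra_simps)
  ultimately have "norm (M x) * norm x \<le> (c * norm x) * norm x"
    by (simp add: dot_square_norm power2_eq_square algebra_simps)
  then show ?thesis using False by simp
qed

text \<open>The involution \<open>A\<close> is an isometry, so Cauchy-Schwarz bounds its form by
  that of \<open>g\<close>. The hypothesis \<open>fg\<close> is
  \<open>(g - f) * (g + c) \<le> g\<^sup>2 - 1\<close> multiplied out.\<close>

lemma involution_quadratic_form_le:
  fixes A :: "'a::real_inner \<Rightarrow> 'a"
  assumes lin: "linear A" and sym: "\<And>x y. A x \<bullet> y = x \<bullet> A y" and inv: "\<And>x. A (A x) = x"
    and orth: "x0 \<bullet> x1 = 0"
    and c: "A x0 \<bullet> x0 \<le> c * (x0 \<bullet> x0)" and "0 \<le> c"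
    and "1 \<le> g" and fg: "1 + c * (g - f) \<le> f * g"
  shows "A (x0 + x1) \<bullet> (x0 + x1) \<le> f * (x0 \<bullet> x0) + g * (x1 \<bullet> x1)"
proof -
  define x where "x = x0 + x1"
  \<comment> \<open>This \<open>s\<close> minimises \<open>s\<^sup>2 * (g + c) - 2 * s\<close>, the
    factor left once \<open>A x0 \<bullet> x0\<close> is replaced by its bound.\<close>
  define s where "s = 1 / (g + c)"
  have gc: "g + c > 0" using assms by simp
  have psd: "A y \<bullet> y \<le> g * (y \<bullet> y)" for y
  proof -
    have "(norm (A y))\<^sup>2 = (norm y)\<^sup>2"
      by (simp add: power2_norm_eq_inner sym inv)
    then have "norm (A y) = norm y" by simp
    then have "A y \<bullet> y \<le> y \<bullet> y"
      using norm_cauchy_schwarz[of "A y" y] by (simp add: dot_square_norm power2_eq_square)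
    also have "\<dots> \<le> g * (y \<bullet> y)"
      using mult_right_mono[OF \<open>1 \<le> g\<close> inner_ge_zero[of y]] by simp
    finally show ?thesis .
  qed
  define y where "y = x - s *\<^sub>R (g *\<^sub>R x0 + A x0)"
  have xx0: "x \<bullet> x0 = x0 \<bullet> x0" "x0 \<bullet> x = x0 \<bullet> x0"
    using orth by (simp_all add: x_def inner_add_left inner_add_right inner_commute)
  \<comment> \<open>By \<open>(g - A) (g + A) = g\<^sup>2 - 1\<close>, the cross terms are multiples
    of \<open>x \<bullet> x0 = x0 \<bullet> x0\<close>.\<close>
  have "g * (y \<bullet> y) - A y \<bullet> y = g * (x \<bullet> x) - A x \<bullet> x
      - 2 * s * (g\<^sup>2 - 1) * (x0 \<bullet> x0)
      + s\<^sup>2 * (g\<^sup>2 - 1) * (g * (x0 \<bullet> x0) + A x0 \<bullet> x0)"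
  proof -
    have e: "A x \<bullet> A x0 = x0 \<bullet> x0" "A x0 \<bullet> A x = x0 \<bullet> x0" "A x0 \<bullet> A x0 = x0 \<bullet> x0"
      "A x \<bullet> x0 = A x0 \<bullet> x" "x \<bullet> A x0 = A x0 \<bullet> x" "x0 \<bullet> A x = A x0 \<bullet> x"
      "x0 \<bullet> A x0 = A x0 \<bullet> x0"
      using sym[of x "A x0"] sym[of x0 "A x"] sym[of x0 "A x0"] sym[of x x0] sym[of x0 x]
      by (simp_all add: inv xx0 inner_commute)
    have Ay: "A y = A x - s *\<^sub>R (g *\<^sub>R A x0 + x0)"
      by (simp add: y_def linear_diff[OF lin] linear_add[OF lin] linear_scale[OF lin] inv)
    show ?thesis
      unfolding Ay
      by (simp add: y_def inner_add_left inner_add_right inner_diff_left inner_diff_right e xx0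
          power2_eq_square algebra_simps)
  qed
  moreover have "s\<^sup>2 * (g\<^sup>2 - 1) * (g * (x0 \<bullet> x0) + A x0 \<bullet> x0)
      \<le> s\<^sup>2 * (g\<^sup>2 - 1) * ((g + c) * (x0 \<bullet> x0))"
    using c \<open>1 \<le> g\<close>
    by (intro mult_left_mono mult_nonneg_nonneg) (simp_all add: algebra_simps one_le_power)
  moreover have "s\<^sup>2 * (g\<^sup>2 - 1) * ((g + c) * (x0 \<bullet> x0)) = s * (g\<^sup>2 - 1) * (x0 \<bullet> x0)"
    using gc by (simp add: s_def power2_eq_square)
  moreover have "A y \<bullet> y \<le> g * (y \<bullet> y)" by (rule psd)
  ultimately have "s * (g\<^sup>2 - 1) * (x0 \<bullet> x0) \<le> g * (x \<bullet> x) - A x \<bullet> x"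
    by simp
  moreover have "(g - f) * (x0 \<bullet> x0) \<le> s * (g\<^sup>2 - 1) * (x0 \<bullet> x0)"
  proof (intro mult_right_mono)
    have "(g - f) * (g + c) \<le> g\<^sup>2 - 1"
      using fg by (simp add: algebra_simps power2_eq_square)
    then show "g - f \<le> s * (g\<^sup>2 - 1)"
      using gc by (simp add: s_def pos_le_divide_eq)
  qed simp
  moreover have "x \<bullet> x = x0 \<bullet> x0 + x1 \<bullet> x1"
    using orth by (simp add: x_def inner_add_left inner_add_right inner_commute)
  ultimately show ?thesis
    unfolding x_def[symmetric] by (simp add: algebra_simps)
qed

section \<open>The bound \<open>zz_bound\<close> as a root of a quadratic\<close>

lemma zz_bound_square: "(zz_bound a b)\<^sup>2 = (1 - b\<^sup>2) * a * zz_bound a b + b\<^sup>2"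
proof -
  define u where "u = (1 - b\<^sup>2) * a"
  define r where "r = sqrt (u\<^sup>2 + 4 * b\<^sup>2)"
  have "r\<^sup>2 = u\<^sup>2 + 4 * b\<^sup>2" by (simp add: r_def)
  moreover have z: "zz_bound a b = (u + r) / 2"
    by (simp add: zz_bound_def r_def u_def power_mult_distrib)
  ultimately show ?thesis
    unfolding u_def[symmetric] z by (simp add: power2_eq_square field_simps)
qed

lemma zz_bound_ge:
  assumes "a \<in> {0..1}" "b \<in> {0..1}"
  shows "b \<le> zz_bound a b"
proof -
  have "2 * b \<le> sqrt ((1 - b\<^sup>2)\<^sup>2 * a\<^sup>2 + 4 * b\<^sup>2)"
    by (intro real_le_rsqrt) (simp add: power_mult_distrib)
  moreover have "0 \<le> (1 - b\<^sup>2) * a"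
    using assms by (simp add: power_le_one)
  ultimately show ?thesis by (simp add: zz_bound_def)
qed

text \<open>Here \<open>q\<close> stands for the squared norm of the component that the small graph
  contracts to \<open>x1\<close>.\<close>

lemma zz_bound_quadratic_form:
  fixes A :: "'a::real_inner \<Rightarrow> 'a"
  assumes lin: "linear A" and sym: "\<And>x y. A x \<bullet> y = x \<bullet> A y" and inv: "\<And>x. A (A x) = x"
    and orth: "x0 \<bullet> x1 = 0"
    and a: "A x0 \<bullet> x0 \<le> a * (x0 \<bullet> x0)"
    and x1: "x1 \<bullet> x1 \<le> b\<^sup>2 * q" and q: "0 \<le> q"
    and ab: "a \<in> {0..1}" "b \<in> {0..1}"
  shows "A (x0 + x1) \<bullet> (x0 + x1) \<le> zz_bound a b * (x0 \<bullet> x0 + q)"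
proof (cases "b = 0")
  \<comment> \<open>The weight \<open>f / b\<^sup>2\<close> degenerates here, but \<open>x1\<close>
    vanishes too.\<close>
  case True
  then have "x1 \<bullet> x1 \<le> 0" using x1 by simp
  then have "x1 = 0" by (metis inner_gt_zero_iff not_le)
  moreover have "zz_bound a b = a" using True ab by (simp add: zz_bound_def)
  moreover have "0 \<le> a * q" using ab q by simp
  ultimately show ?thesis using a by (simp add: algebra_simps)
next
  case False
  define f where "f = zz_bound a b"
  define g where "g = f / b\<^sup>2"
  have b: "0 < b" "b \<le> 1" using False ab by auto
  have f: "b \<le> f" unfolding f_def using ab by (rule zz_bound_ge)
  have "b\<^sup>2 \<le> b" using b by (simp add: power2_eq_square mult_left_le)
  then have "1 \<le> g" using f b by (simp add: g_def)
  \<comment> \<open>Multiplied by \<open>b\<^sup>2\<close>, this is the quadratic equation of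
    \<open>zz_bound\<close>.\<close>
  moreover have "1 + a * (g - f) = f * g"
  proof -
    have "b\<^sup>2 * g = f" using b by (simp add: g_def)
    then have "b\<^sup>2 * (1 + a * (g - f)) = b\<^sup>2 + (1 - b\<^sup>2) * a * f"
      by (simp add: algebra_simps)
    also have "\<dots> = f\<^sup>2"
      using zz_bound_square[of a b] by (simp add: f_def)
    also have "\<dots> = b\<^sup>2 * (f * g)"
      using \<open>b\<^sup>2 * g = f\<close> by (simp add: power2_eq_square[of f] mult.left_commute)
    finally show ?thesis using b by simp
  qed
  ultimately have "A (x0 + x1) \<bullet> (x0 + x1) \<le> f * (x0 \<bullet> x0) + g * (x1 \<bullet> x1)"
    using ab by (intro involution_quadratic_form_le[OF lin sym inv orth a]) auto
  also have "g * (x1 \<bullet> x1) \<le> g * (b\<^sup>2 * q)"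
    using x1 \<open>1 \<le> g\<close> by (intro mult_left_mono) auto
  also have "g * (b\<^sup>2 * q) = f * q"
    using b by (simp add: g_def)
  finally show ?thesis by (simp add: f_def algebra_simps)
qed

section \<open>Adjacency matrices of rotation maps\<close>

lemma adj_matrix_mult:
  fixes G :: "('v::finite, 'l::finite) rot"
  shows "(adj_matrix G *v x) $ u = (\<Sum>i\<in>UNIV. x $ fst (G (u, i))) / real CARD('l)"
proof -
  have card: "real (card {(i, j). G (u, i) = (v, j)}) =
      (\<Sum>i\<in>UNIV. if fst (G (u, i)) = v then 1 else 0)" for v
  proof -
    have "{(i, j). G (u, i) = (v, j)} = (\<lambda>i. (i, snd (G (u, i)))) ` {i. fst (G (u, i)) = v}"
      by force
    then have "card {(i, j). G (u, i) = (v, j)} = card {i. fst (G (u, i)) = v}"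
      by (simp add: card_image inj_on_def)
    then show ?thesis
      by (simp add: sum.If_cases)
  qed
  have "(\<Sum>v\<in>UNIV. real (card {(i, j). G (u, i) = (v, j)}) * x $ v) = (\<Sum>i\<in>UNIV. x $ fst (G (u, i)))"
    unfolding card sum_distrib_right
    by (subst sum.swap) (simp add: if_distrib[of "\<lambda>t. t * _"] cong: if_cong)
  then show ?thesis
    by (simp add: matrix_vector_mult_def adj_matrix_def flip: sum_divide_distrib)
qed

text \<open>Reindexing along the bijection \<open>G\<close> reads every edge from its other end;
  this is the source of symmetry for both \<open>adj_matrix\<close> and
  \<open>permute\<close>.\<close>

lemma sum_rotation_map:
  fixes G :: "('v::finite, 'l::finite) rot" and h :: "_ \<Rightarrow> _ \<Rightarrow> real"
  assumes "rotation_map G"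
  shows "(\<Sum>p\<in>UNIV. h (G p) p) = (\<Sum>p\<in>UNIV. h p (G p))"
proof -
  have "G (G p) = p" for p
    using assms by (metis comp_apply id_apply rotation_map_def)
  then show ?thesis
    using sum.reindex_bij_betw[OF rotation_map_bij[OF assms], of "\<lambda>p. h (G p) p"] by simp
qed

lemma inner_adj_matrix:
  fixes G :: "('v::finite, 'l::finite) rot"
  shows "(adj_matrix G *v x) \<bullet> y = (\<Sum>p\<in>UNIV. x $ fst (G p) * y $ fst p) / real CARD('l)"
  by (simp add: inner_vec_def adj_matrix_mult sum_distrib_right sum.cartesian_product
      case_prod_beta flip: sum_divide_distrib)

lemma adj_matrix_symmetric:
  assumes "rotation_map G"
  shows "(adj_matrix G *v x) \<bullet> y = x \<bullet> (adj_matrix G *v y)"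
  using sum_rotation_map[OF assms, of "\<lambda>p q. x $ fst p * y $ fst q"]
  by (simp add: inner_adj_matrix inner_commute[of x] mult.commute)

lemma adj_matrix_const: "adj_matrix G *v (\<chi> v. c) = (\<chi> v. c)"
  by (simp add: vec_eq_iff adj_matrix_mult)

lemma adj_matrix_orthogonal_one:
  assumes "rotation_map G"
  shows "(adj_matrix G *v x) \<bullet> (\<chi> v. 1) = x \<bullet> (\<chi> v. 1)"
  by (simp add: adj_matrix_symmetric[OF assms] adj_matrix_const)

lemma norm_adj_matrix_le:
  fixes G :: "('v::finite, 'l::finite) rot"
  assumes "second_eigenvalue G \<le> l" and x: "x \<bullet> (\<chi> v. 1) = 0"
  shows "norm (adj_matrix G *v x) \<le> l * norm x"
proof (cases "x = 0")
  case False
  \<comment> \<open>On a single vertex, orthogonality to the constants already forces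
    \<open>x = 0\<close>.\<close>
  have "CARD('v) \<noteq> 1"
  proof
    assume "CARD('v) = 1"
    then obtain a :: 'v where a: "UNIV = {a}" by (auto simp: card_1_singleton_iff)
    then have "v = a" for v by auto
    moreover have "x $ a = 0" using x by (simp add: inner_vec_def a)
    ultimately have "x = 0" by (metis vec_eq_iff zero_index)
    then show False using False by simp
  qed
  moreover have "norm (adj_matrix G *v x) / norm x \<in> eigen_ratios G"
    unfolding eigen_ratios_def using x False by blast
  ultimately have "norm (adj_matrix G *v x) / norm x \<le> l"
    using second_eigenvalue_max(2) assms(1) by fastforce
  then show ?thesis using False by (simp add: pos_divide_le_eq)
qed simp

lemma second_eigenvalue_le:
  fixes G :: "('v::finite, 'l::finite) rot"
  assumes "0 \<le> l" and "\<And>x. x \<bullet> (\<chi> v. 1) = 0 \<Longrightarrow> norm (adj_matrix G *v x) \<le> l * norm x"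
  shows "second_eigenvalue G \<le> l"
proof (cases "CARD('v) = 1")
  case True
  then show ?thesis using assms by (simp add: second_eigenvalue_def)
next
  case False
  from second_eigenvalue_max(1)[OF False, of G] obtain x :: "real ^ 'v"
    where x: "x \<bullet> (\<chi> v. 1) = 0" "x \<noteq> 0"
      and eq: "second_eigenvalue G = norm (adj_matrix G *v x) / norm x"
    unfolding eigen_ratios_def by blast
  show ?thesis unfolding eq using assms(2)[OF x(1)] x(2) by (simp add: pos_divide_le_eq)
qed

section \<open>The zig-zag product\<close>

text \<open>The swapped labels \<open>(j', i')\<close> in the result let a second application
  retrace the three steps backwards.\<close>

lemma rotation_map_zig_zag:
  assumes "rotation_map G1" "rotation_map G2"
  shows "rotation_map (zig_zag G1 G2)"
proof -
  have inv: "G1 (G1 p) = p" "G2 (G2 q) = q" for p q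
    using assms by (metis comp_apply id_apply rotation_map_def)+
  show ?thesis
    unfolding rotation_map_def
    by (simp add: fun_eq_iff zig_zag_def Let_def case_prod_beta inv)
qed

section \<open>Operators on the clouds\<close>

definition slice :: "real ^ ('v::finite \<times> 'd::finite) \<Rightarrow> 'v \<Rightarrow> real ^ 'd" where
  "slice x v = (\<chi> k. x $ (v, k))"

text \<open>The Kronecker product of the identity with \<open>B\<close>.\<close>

definition cloudwise :: "real ^ 'd ^ 'd \<Rightarrow> real ^ ('v::finite \<times> 'd::finite) \<Rightarrow> real ^ ('v \<times> 'd)" where
  "cloudwise B x = (\<chi> p. (B *v slice x (fst p)) $ snd p)"

text \<open>Vertices of the product are edge ends of \<open>G1\<close>, so \<open>G1\<close> itself
  acts on vectors over them.\<close>

definition permute :: "('p::finite \<Rightarrow> 'p) \<Rightarrow> real ^ 'p \<Rightarrow> real ^ 'p" where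
  "permute G x = (\<chi> p. x $ G p)"

lemma slice_cloudwise [simp]: "slice (cloudwise B x) v = B *v slice x v"
  by (simp add: slice_def[of "cloudwise B x"] vec_eq_iff) (simp add: cloudwise_def)

lemma inner_slices:
  fixes x y :: "real ^ ('v::finite \<times> 'd::finite)"
  shows "x \<bullet> y = (\<Sum>v\<in>UNIV. slice x v \<bullet> slice y v)"
  by (simp add: inner_vec_def slice_def sum.cartesian_product case_prod_beta)

lemma slice_add: "slice (x + y) v = slice x v + slice y v"
  by (simp add: slice_def vec_eq_iff)

lemma cloudwise_add: "cloudwise B (x + y) = cloudwise B x + cloudwise B y"
  by (simp add: cloudwise_def vec_eq_iff slice_add matrix_vector_right_distrib)

lemma cloudwise_adj_symmetric:
  assumes "rotation_map G"
  shows "cloudwise (adj_matrix G) x \<bullet> y = x \<bullet> cloudwise (adj_matrix G) y"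
  by (simp add: inner_slices adj_matrix_symmetric[OF assms])

lemma linear_permute: "linear (permute G)"
  by (rule linearI) (simp_all add: permute_def vec_eq_iff)

lemma permute_rotation_map_symmetric:
  assumes "rotation_map G"
  shows "permute G x \<bullet> y = x \<bullet> permute G y"
  using sum_rotation_map[OF assms, of "\<lambda>p q. x $ p * y $ q"]
  by (simp add: permute_def inner_vec_def)

lemma permute_rotation_map_involution:
  assumes "rotation_map G"
  shows "permute G (permute G x) = x"
proof -
  have "G (G p) = p" for p
    using assms by (metis comp_apply id_apply rotation_map_def)
  then show ?thesis by (simp add: permute_def vec_eq_iff)
qed

text \<open>The label \<open>i\<close> governs only the first small step and \<open>j\<close> only
  the second, so the average over \<open>(i, j)\<close> factors into two averages around the step of
  \<open>G1\<close>.\<close>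

lemma adj_matrix_zig_zag:
  fixes G1 :: "('v::finite, 'd::finite) rot" and G2 :: "('d, 'e::finite) rot"
  shows "adj_matrix (zig_zag G1 G2) *v x =
    cloudwise (adj_matrix G2) (permute G1 (cloudwise (adj_matrix G2) x))"
proof (subst vec_eq_iff, rule allI)
  fix p :: "'v \<times> 'd"
  obtain v k where p: "p = (v, k)" by force
  have zz: "fst (zig_zag G1 G2 ((v, k), (i, j))) =
      (fst (G1 (v, fst (G2 (k, i)))), fst (G2 (snd (G1 (v, fst (G2 (k, i)))), j)))" for i j
    by (simp add: zig_zag_def Let_def case_prod_beta)
  have "(adj_matrix (zig_zag G1 G2) *v x) $ p =
      (\<Sum>i\<in>UNIV. \<Sum>j\<in>UNIV. x $ fst (zig_zag G1 G2 ((v, k), (i, j)))) / (real CARD('e) * real CARD('e))"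
    by (simp add: adj_matrix_mult p sum.cartesian_product)
  also have "\<dots> = cloudwise (adj_matrix G2) (permute G1 (cloudwise (adj_matrix G2) x)) $ p"
    by (simp add: zz p cloudwise_def adj_matrix_mult slice_def permute_def
        flip: sum_divide_distrib)
  finally show "(adj_matrix (zig_zag G1 G2) *v x) $ p =
      cloudwise (adj_matrix G2) (permute G1 (cloudwise (adj_matrix G2) x)) $ p" .
qed

text \<open>On vectors constant on clouds, the form of \<open>permute G\<close> is a sum over edge
  ends of \<open>G\<close>, hence \<open>CARD('d)\<close> times the form of its adjacency
  matrix.\<close>

lemma abs_permute_lift_le:
  fixes G :: "('v::finite, 'd::finite) rot" and m :: "real ^ 'v"
  defines "x \<equiv> \<chi> p. m $ fst p"
  assumes "second_eigenvalue G \<le> l" and "m \<bullet> (\<chi> v. 1) = 0"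
  shows "\<bar>permute G x \<bullet> x\<bar> \<le> l * (x \<bullet> x)"
proof -
  have "permute G x \<bullet> x = real CARD('d) * ((adj_matrix G *v m) \<bullet> m)"
    by (simp add: inner_adj_matrix) (simp add: x_def permute_def inner_vec_def)
  moreover have "x \<bullet> x = real CARD('d) * (m \<bullet> m)"
    by (simp add: inner_slices) (simp add: x_def slice_def inner_vec_def sum_distrib_left)
  moreover have "\<bar>(adj_matrix G *v m) \<bullet> m\<bar> \<le> l * (m \<bullet> m)"
  proof -
    have "\<bar>(adj_matrix G *v m) \<bullet> m\<bar> \<le> norm (adj_matrix G *v m) * norm m"
      by (rule Cauchy_Schwarz_ineq2)
    also have "\<dots> \<le> (l * norm m) * norm m"
      by (intro mult_right_mono norm_adj_matrix_le assms norm_ge_zero)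
    finally show ?thesis by (simp add: dot_square_norm power2_eq_square mult.assoc)
  qed
  ultimately show ?thesis
    by (simp add: abs_mult mult.left_commute[of l] mult_left_mono)
qed

lemma zig_zag_quadratic_form:
  fixes G1 :: "('v::finite, 'd::finite) rot" and G2 :: "('d, 'e::finite) rot"
  assumes rot: "rotation_map G1" "rotation_map G2"
    and ev: "second_eigenvalue G1 \<le> a" "second_eigenvalue G2 \<le> b"
    and ab: "a \<in> {0..1}" "b \<in> {0..1}"
    and x: "x \<bullet> (\<chi> p. 1) = 0"
  shows "\<bar>(adj_matrix (zig_zag G1 G2) *v x) \<bullet> x\<bar> \<le> zz_bound a b * (x \<bullet> x)"
proof -
  let ?A = "permute G1" and ?B = "cloudwise (adj_matrix G2) :: real ^ ('v \<times> 'd) \<Rightarrow> _"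
  define m :: "real ^ 'v" where "m = (\<chi> v. (\<Sum>k\<in>UNIV. x $ (v, k)) / real CARD('d))"
  define x0 :: "real ^ ('v \<times> 'd)" where "x0 = (\<chi> p. m $ fst p)"
  define y where "y = x - x0"
  define x1 where "x1 = ?B y"
  have slice_x0: "slice x0 v = (\<chi> k. m $ v)" for v
    by (simp add: x0_def slice_def)
  have slice_y: "slice y v \<bullet> (\<chi> k. 1) = 0" for v
    by (simp add: y_def x0_def slice_def inner_vec_def sum_subtractf m_def)
  have orth_const: "(\<chi> k. c) \<bullet> z = 0" if "z \<bullet> (\<chi> k. 1) = 0" for c and z :: "real ^ 'd"
    using that by (simp add: inner_vec_def flip: sum_distrib_left)
  have "?B x0 = x0"
    by (simp add: cloudwise_def slice_x0 adj_matrix_const) (simp add: x0_def)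
  moreover have "x = x0 + y" by (simp add: y_def)
  ultimately have Bx: "?B x = x0 + x1" by (simp add: x1_def cloudwise_add)
  have "x0 \<bullet> y = 0"
    by (simp add: inner_slices slice_x0 orth_const slice_y)
  then have norm_x: "x \<bullet> x = x0 \<bullet> x0 + y \<bullet> y"
    by (simp add: \<open>x = x0 + y\<close> inner_add_left inner_add_right inner_commute)
  \<comment> \<open>The matrix of \<open>G2\<close> preserves the zero sum of every cloud of
    \<open>y\<close>.\<close>
  have orth: "x0 \<bullet> x1 = 0"
    by (simp add: x1_def inner_slices slice_x0 orth_const slice_y adj_matrix_orthogonal_one rot)
  have "(adj_matrix G2 *v slice y v) \<bullet> (adj_matrix G2 *v slice y v)
      \<le> b\<^sup>2 * (slice y v \<bullet> slice y v)" for v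
  proof -
    have "(norm (adj_matrix G2 *v slice y v))\<^sup>2 \<le> (b * norm (slice y v))\<^sup>2"
      by (intro power_mono norm_adj_matrix_le ev slice_y norm_ge_zero)
    then show ?thesis by (simp add: power2_norm_eq_inner power_mult_distrib)
  qed
  then have x1: "x1 \<bullet> x1 \<le> b\<^sup>2 * (y \<bullet> y)"
    by (simp add: x1_def inner_slices sum_distrib_left sum_mono)
  \<comment> \<open>The averages inherit total sum zero from \<open>x\<close>, as the expansion of
    \<open>G1\<close> requires.\<close>
  have "m \<bullet> (\<chi> v. 1) = x \<bullet> (\<chi> p. 1) / real CARD('d)"
    by (simp add: m_def inner_vec_def sum.cartesian_product case_prod_beta
        flip: sum_divide_distrib)
  then have "m \<bullet> (\<chi> v. 1) = 0" using x by simp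
  from abs_permute_lift_le[OF ev(1) this]
  have A: "\<bar>?A x0 \<bullet> x0\<bar> \<le> a * (x0 \<bullet> x0)" by (simp add: x0_def)
  note A_props = linear_permute[of G1] permute_rotation_map_symmetric[OF rot(1)]
    permute_rotation_map_involution[OF rot(1)]
  have "?A (x0 + x1) \<bullet> (x0 + x1) \<le> zz_bound a b * (x0 \<bullet> x0 + y \<bullet> y)"
    by (rule zz_bound_quadratic_form[OF A_props orth _ x1 inner_ge_zero ab]) (use A in simp)
  moreover
  \<comment> \<open>The lower bound comes from \<open>- ?A\<close>, which is again a symmetric
    involution.\<close>
  have "- ?A (x0 + x1) \<bullet> (x0 + x1) \<le> zz_bound a b * (x0 \<bullet> x0 + y \<bullet> y)"
    by (rule zz_bound_quadratic_form[where A = "\<lambda>z. - ?A z", OF _ _ _ orth _ x1 inner_ge_zero ab])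
      (use A in \<open>simp_all add: A_props linear_compose_neg linear_neg[OF linear_permute]\<close>)
  moreover have "(adj_matrix (zig_zag G1 G2) *v x) \<bullet> x = ?A (x0 + x1) \<bullet> (x0 + x1)"
    by (simp add: adj_matrix_zig_zag cloudwise_adj_symmetric rot Bx)
  ultimately show ?thesis by (simp add: norm_x)
qed

theorem theorem4p3:
  fixes G1 :: "('v::finite, 'd::finite) rot"
    and G2 :: "('d, 'e::finite) rot"
    and N1 D1 D2 :: nat
    and lam1 lam2 :: real
  assumes "lam1 \<in> {0..1}" and "lam2 \<in> {0..1}"
    and "expander_graph N1 D1 lam1 G1"
    and "expander_graph D1 D2 lam2 G2"
  shows "expander_graph (N1 * D1) (D2\<^sup>2) (zz_bound lam1 lam2) (zig_zag G1 G2)"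
proof -
  have rot: "rotation_map G1" "rotation_map G2"
    and ev: "second_eigenvalue G1 \<le> lam1" "second_eigenvalue G2 \<le> lam2"
    and card: "CARD('v) = N1" "CARD('d) = D1" "CARD('e) = D2"
    using assms(3,4) by (auto simp: expander_graph_def)
  have zz: "rotation_map (zig_zag G1 G2)" by (rule rotation_map_zig_zag[OF rot])
  have nonneg: "0 \<le> zz_bound lam1 lam2"
    using zz_bound_ge[OF assms(1,2)] assms(2) by simp
  have "second_eigenvalue (zig_zag G1 G2) \<le> zz_bound lam1 lam2"
  proof (rule second_eigenvalue_le[OF nonneg])
    fix x :: "real ^ ('v \<times> 'd)"
    assume x: "x \<bullet> (\<chi> p. 1) = 0"
    \<comment> \<open>The form is bounded only on this complement of the constants, which is
      invariant because the matrix is symmetric and fixes them.\<close>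
    let ?S = "{x :: real ^ ('v \<times> 'd). x \<bullet> (\<chi> p. 1) = 0}"
    show "norm (adj_matrix (zig_zag G1 G2) *v x) \<le> zz_bound lam1 lam2 * norm x"
    proof (rule symmetric_norm_le_quadratic_form[where S = ?S])
      show "subspace ?S" by (simp add: subspace_def inner_add_left)
    next
      fix y z :: "real ^ ('v \<times> 'd)"
      show "(adj_matrix (zig_zag G1 G2) *v y) \<bullet> z = y \<bullet> (adj_matrix (zig_zag G1 G2) *v z)"
        by (rule adj_matrix_symmetric[OF zz])
    qed (use x in \<open>auto intro!: zig_zag_quadratic_form[OF rot ev assms(1,2)]
        simp: nonneg adj_matrix_orthogonal_one[OF zz]\<close>)
  qed
  then show ?thesis
    by (simp add: expander_graph_def zz card power2_eq_square)
qed

end
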